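(* Let $f\in M_0^!$ be a weakly holomorphic modular function of weight $0$ for $\mathrm{SL}_2(\mathbb Z)$ with Fourier expansion $f(z)=\sum_{n\gg-\infty}a(n)e^{2\pi i n z}$ and vanishing constant coefficient $a(0)=0$. Let $C_Q$ denote the imaginary axis, and define $$\int^{reg}_{C_Q} f(z)\,\frac{dz}{z}:=2\sum_{n\neq 0}a(n)\,\mathcal{EI}(2\pi n).$$ Then for every $T>0$, $$\int^{reg}_{C_Q} f(z)\,\frac{dz}{z}=2\int_{i}^{iT} f(z)\,\frac{dz}{z}-\int_{iT}^{iT+1} f(z)\big(\psi(z)+\psi(1-z)\big)\,dz,$$ where the first integral on the right is along the imaginary axis and the second along the horizontal segment from $iT$ to $iT+1$.
   Context: $M_0^!=\mathbb C[j]$ is the space of holomorphic functions on the upper half plane $\mathbb H$ invariant under $\mathrm{SL}_2(\mathbb Z)$ and meromorphic at the cusp. For real $w\neq0$, $\mathcal{EI}(w):=\int_w^\infty e^{-t}\,\frac{dt}{t}$, where for $w<0$ the integral is taken as a Cauchy principal value (so $\mathcal{EI}(w)=E_1(w)$ for $w>0$ and $\mathcal{EI}(w)=-\mathrm{Ei}(-w)$ for $w<0$). $\psi(z)=\Gamma'(z)/\Gamma(z)$ is the digamma function. *)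

theory Defs
  imports "HOL-Complex_Analysis.Complex_Analysis"
begin

definition upper_half_plane :: "complex set" where
  "upper_half_plane = {z. Im z > 0}"

(* The space of weight 0: only the values of f on the upper half plane matter.
   Meromorphic at the cusp: as a function of q = exp (2 pi i z), f extends
   meromorphically to q = 0. *)
definition weakly_holomorphic_modular_function :: "(complex \<Rightarrow> complex) \<Rightarrow> bool" where
  "weakly_holomorphic_modular_function f \<longleftrightarrow>
     f holomorphic_on upper_half_plane \<and>
     (\<forall>a b c d :: int. a * d - b * c = 1 \<longrightarrow>
        (\<forall>z\<in>upper_half_plane.
           f ((of_int a * z + of_int b) / (of_int c * z + of_int d)) = f z)) \<and>
     (\<exists>g. g meromorphic_on {0} \<and>
        (\<forall>z\<in>upper_half_plane. f z = g (exp (2 * of_real pi * \<i> * z))))"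

definition has_fourier_expansion :: "(complex \<Rightarrow> complex) \<Rightarrow> (int \<Rightarrow> complex) \<Rightarrow> bool" where
  "has_fourier_expansion f a \<longleftrightarrow>
     (\<exists>N. \<forall>n<N. a n = 0) \<and>
     (\<forall>z\<in>upper_half_plane.
        ((\<lambda>n. a n * exp (2 * of_real pi * \<i> * of_int n * z)) has_sum f z) UNIV)"

(* For w < 0 this is the Cauchy principal value at the pole t = 0;
   the value at w = 0 is irrelevant. *)
definition EI :: "real \<Rightarrow> real" where
  "EI w =
     (if w > 0 then integral {w..} (\<lambda>t. exp (-t) / t)
      else Lim (at_right 0) (\<lambda>\<epsilon>. integral {w..-\<epsilon>} (\<lambda>t. exp (-t) / t)
                                 + integral {\<epsilon>..} (\<lambda>t. exp (-t) / t)))"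

(* The regularized integral of f(z) dz/z along the imaginary axis, in terms of the
   Fourier coefficients a of f. *)
definition reg_integral_CQ :: "(int \<Rightarrow> complex) \<Rightarrow> complex" where
  "reg_integral_CQ a = 2 * (\<Sum>\<^sub>\<infinity>n\<in>{n. n \<noteq> 0}. a n * of_real (EI (2 * pi * of_int n)))"

(* The library's Digamma is defined by a series; this is the usual description. *)
lemma Digamma_eq_logderiv_Gamma:
  fixes z :: complex
  assumes "z \<notin> \<int>\<^sub>\<le>\<^sub>0"
  shows "Digamma z = deriv Gamma z / Gamma z"
  using DERIV_imp_deriv[OF has_field_derivative_Gamma[OF assms, where A = UNIV]] assms
  by (simp add: Gamma_eq_zero_iff)

end

(* Put e_n(z) = exp (2 pi i n z). The Fourier series of f converges uniformly on both segments, so it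
   suffices to treat each e_n with n nonzero separately. The entire function
   Ein(z) = \<integral>_0^z (1 - exp (-t)) / t dt satisfies EI(w) = Ein(w) - ln |w| - c on both real half lines: the
   principal value is exactly what makes the same constant c appear for w < 0. Hence
   Ln z - Ein(-2 pi i n z) is a primitive of e_n(z) / z, which gives the vertical integral.
   By the periodicity of e_n, the series of Digamma unfolds the horizontal integral of
   e_n(z) (Digamma z + Digamma (1 - z)) to integrals of e_n(z) / z over the whole line Im z = T; they
   telescope, and Ein(z) - Ln z \<longlonglongrightarrow> c along horizontal and vertical lines yields -2 EI(2 pi n T),
   for n of either sign. The dependence on T cancels. *)

theory Submission
  imports Defs
begin

section \<open>The entire function \<open>Ein\<close>\<close>

text \<open>This is the complementary exponential integral. Being entire, it carries no branch cut,
  unlike E_1; the value 1 at 0 fills the removable singularity of the integrand. Derivative and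
  value at 0 determine the function uniquely.\<close>

definition Ein :: "complex \<Rightarrow> complex" where
  "Ein = (SOME E. E 0 = 0 \<and>
     (\<forall>z. (E has_field_derivative (if z = 0 then 1 else (1 - exp (- z)) / z)) (at z)))"

text \<open>A function on a convex set that is continuous, and holomorphic off a finite set, has a
  primitive. So at 0 only continuity of the integrand has to be checked, and there its limit is the
  derivative of \<open>1 - exp (- z)\<close>. Subtracting a constant normalises the
  primitive.\<close>

lemma Ein_properties:
  "Ein 0 = 0 \<and> (\<forall>z. (Ein has_field_derivative (if z = 0 then 1 else (1 - exp (- z)) / z)) (at z))"
proof -
  define g :: "complex \<Rightarrow> complex" where "g = (\<lambda>z. if z = 0 then 1 else (1 - exp (- z)) / z)"
  have *: "isCont g z" for z
  proof (cases "z = 0")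
    case True
    have "((\<lambda>z::complex. 1 - exp (- z)) has_field_derivative 1) (at 0)"
      by (auto intro!: derivative_eq_intros)
    then have "((\<lambda>h::complex. (1 - exp (- h)) / h) \<longlongrightarrow> 1) (at 0)"
      by (simp add: DERIV_def)
    then have "(g \<longlongrightarrow> 1) (at 0)"
      by (rule Lim_transform_eventually) (auto simp: g_def eventually_at_filter)
    then show ?thesis
      using True by (simp add: isCont_def g_def)
  next
    case False
    have "isCont (\<lambda>z::complex. (1 - exp (- z)) / z) z"
      using False by (intro continuous_intros) auto
    moreover have "eventually (\<lambda>x. (1 - exp (- x)) / x = g x) (nhds z)"
      using t1_space_nhds[OF False] by eventually_elim (auto simp: g_def)
    ultimately show ?thesis
      using isCont_cong[where f = "\<lambda>z. (1 - exp (- z)) / z" and g = g] by simp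
  qed
  have "g field_differentiable at z" if "z \<in> interior UNIV - {0}" for z
  proof -
    have "((\<lambda>z::complex. (1 - exp (- z)) / z) has_field_derivative
            (exp (- z) * z - (1 - exp (- z))) / (z * z)) (at z)"
      using that by (auto intro!: derivative_eq_intros)
    then have "(g has_field_derivative (exp (- z) * z - (1 - exp (- z))) / (z * z)) (at z)"
      by (rule has_field_derivative_transform_within_open[of _ _ _ "- {0}"])
         (use that in \<open>auto simp: g_def\<close>)
    then show ?thesis
      by (auto simp: field_differentiable_def)
  qed
  then obtain E where "\<And>z. (E has_field_derivative g z) (at z)"
    using holomorphic_convex_primitive[of UNIV "{0}" g] *
    by (auto simp: continuous_on_eq_continuous_at)
  then have "\<forall>z. ((\<lambda>z. E z - E 0) has_field_derivative g z) (at z)"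
    by (auto intro!: derivative_eq_intros)
  then have "\<exists>E. E 0 = 0 \<and> (\<forall>z. (E has_field_derivative g z) (at z))"
    by (intro exI[of _ "\<lambda>z. E z - E 0"]) auto
  then show ?thesis
    unfolding Ein_def g_def by (rule someI_ex)
qed

lemma has_field_derivative_Ein [derivative_intros]:
  assumes "(f has_field_derivative f') (at z within S)" "f z \<noteq> 0"
  shows "((\<lambda>z. Ein (f z)) has_field_derivative (1 - exp (- f z)) / f z * f') (at z within S)"
proof (rule DERIV_chain2[OF _ assms(1)])
  show "(Ein has_field_derivative (1 - exp (- f z)) / f z) (at (f z))"
    using Ein_properties assms(2) by metis
qed

lemma continuous_Ein: "isCont Ein z"
  using Ein_properties DERIV_isCont by blast

section \<open>Restriction to the real axis and the constant at infinity\<close>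

definition ein :: "real \<Rightarrow> real" where
  "ein x = Re (Ein (of_real x))"

text \<open>The derivative of \<open>Ein\<close> is real on the real axis, so the imaginary part is
  constant there and equals its value 0 at the origin. Hence taking \<open>Re\<close> in
  \<open>ein\<close> loses nothing.\<close>

lemma
  shows Ein_of_real: "Ein (of_real x) = of_real (ein x)"
    and DERIV_ein: "x \<noteq> 0 \<Longrightarrow> (ein has_field_derivative (1 - exp (- x)) / x) (at x)"
proof -
  define g :: "real \<Rightarrow> real" where "g = (\<lambda>x. if x = 0 then 1 else (1 - exp (- x)) / x)"
  have g: "(if complex_of_real x = 0 then 1 else (1 - exp (- complex_of_real x)) / of_real x) = of_real (g x)"
    for x by (simp add: g_def flip: exp_of_real)
  have *: "((\<lambda>x. Ein (of_real x)) has_vector_derivative of_real (g x)) (at x)" for x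
    using has_vector_derivative_real_field[OF Ein_properties[THEN conjunct2, rule_format, of "of_real x"]]
    unfolding g .
  have "((\<lambda>x. Im (Ein (of_real x))) has_field_derivative 0) (at x)" for x
    using bounded_linear.has_vector_derivative[OF bounded_linear_Im *[of x]] by (simp add: has_real_derivative_iff_has_vector_derivative)
  then have "Im (Ein (of_real x)) = Im (Ein (of_real 0))"
    using DERIV_isconst_all by blast
  then show "Ein (of_real x) = of_real (ein x)"
    using Ein_properties by (simp add: ein_def complex_eq_iff)
  show "(ein has_field_derivative (1 - exp (- x)) / x) (at x)" if "x \<noteq> 0"
    using bounded_linear.has_vector_derivative[OF bounded_linear_Re *[of x]] that
    by (simp add: has_real_derivative_iff_has_vector_derivative ein_def[abs_def] g_def)
qed

lemma DERIV_ein_minus_ln: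
  assumes "x > 0"
  shows "((\<lambda>x. ein x - ln x) has_field_derivative - exp (- x) / x) (at x)"
  using assms by (auto intro!: derivative_eq_intros DERIV_ein simp: field_simps)

lemma ein_minus_ln_antimono:
  assumes "0 < x" "x \<le> y"
  shows "ein y - ln y \<le> ein x - ln x"
  by (rule DERIV_nonpos_imp_nonincreasing[OF assms(2)])
     (use assms in \<open>auto intro!: exI DERIV_ein_minus_ln\<close>)

text \<open>The value is Euler's constant. Since \<open>ein x - ln x\<close> decreases, the infimum
  is also its limit at infinity.\<close>

definition Ein_const :: real where
  "Ein_const = (INF x\<in>{1..}. ein x - ln x)"

lemma tendsto_ein_minus_ln: "((\<lambda>x. ein x - ln x) \<longlongrightarrow> Ein_const) at_top"
proof -
  have bdd: "bdd_below ((\<lambda>x. ein x - ln x) ` {1..})"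
  proof (rule bdd_belowI2)
    fix x :: real assume "x \<in> {1..}"
    then have "1 \<le> x" by simp
    \<comment> \<open>Subtracting \<open>exp (- x)\<close> turns the decreasing function into an
      increasing one on \<open>x \<ge> 1\<close>: the derivative becomes
      \<open>exp (- t) * (1 - 1 / t)\<close>. The value at 1 then gives a lower bound.\<close>
    have "ein 1 - ln 1 - exp (- 1) \<le> ein x - ln x - exp (- x)"
    proof (rule DERIV_nonneg_imp_nondecreasing[OF \<open>1 \<le> x\<close>])
      fix t :: real assume t: "1 \<le> t"
      have "((\<lambda>x. ein x - ln x - exp (- x)) has_field_derivative - exp (- t) / t + exp (- t)) (at t)"
        using t by (intro DERIV_cong[OF DERIV_diff[OF DERIV_ein_minus_ln DERIV_fun_exp[OF DERIV_minus[OF DERIV_ident]]]]) auto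
      moreover have "- exp (- t) / t + exp (- t) \<ge> 0"
        using t by (simp add: field_simps)
      ultimately show "\<exists>y. ((\<lambda>x. ein x - ln x - exp (- x)) has_field_derivative y) (at t) \<and> 0 \<le> y"
        by blast
    qed
    then show "ein 1 - exp (- 1) \<le> ein x - ln x"
      using exp_gt_zero[of "- x"] by (simp del: exp_gt_zero)
  qed
  show ?thesis
  proof (rule decreasing_tendsto)
    show "\<forall>\<^sub>F x in at_top. Ein_const \<le> ein x - ln x"
      using eventually_ge_at_top[of 1]
      by eventually_elim (auto simp: Ein_const_def intro!: cINF_lower bdd)
  next
    fix y assume "Ein_const < y"
    then obtain x where x: "x \<ge> 1" "ein x - ln x < y"
      unfolding Ein_const_def by (subst (asm) cINF_less_iff[OF _ bdd]) auto
    show "\<forall>\<^sub>F x in at_top. ein x - ln x < y"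
      using eventually_ge_at_top[of x]
      by eventually_elim (use ein_minus_ln_antimono x in \<open>smt (verit)\<close>)
  qed
qed

section \<open>The exponential integral on both half lines\<close>

text \<open>The primitive \<open>- (ein x - ln x)\<close> tends to \<open>- Ein_const\<close>. As
  the integrand is nonnegative, the fundamental theorem on a half line applies to the nonnegative
  Lebesgue integral, which is then converted to the gauge integral.\<close>

lemma integral_exp_over_atLeast:
  assumes "w > 0"
  shows "integral {w..} (\<lambda>t. exp (- t) / t) = ein w - ln w - Ein_const"
proof -
  have ge: "ein w - ln w \<ge> Ein_const"
  proof (rule tendsto_upperbound[OF tendsto_ein_minus_ln])
    show "\<forall>\<^sub>F x in at_top. ein x - ln x \<le> ein w - ln w"
      using eventually_ge_at_top[of w]
      by eventually_elim (use assms ein_minus_ln_antimono in blast)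
  qed auto
  have "(\<integral>\<^sup>+x. ennreal (exp (- x) / x) * indicator {w..} x \<partial>lborel)
          = ennreal (- Ein_const - (- (ein w - ln w)))"
  proof (rule nn_integral_FTC_atLeast)
    show "((\<lambda>x. - (ein x - ln x)) \<longlongrightarrow> - Ein_const) at_top"
      by (intro tendsto_intros tendsto_ein_minus_ln)
    fix x assume "w \<le> x"
    then show "((\<lambda>x. - (ein x - ln x)) has_field_derivative exp (- x) / x) (at x)"
      using assms DERIV_minus[OF DERIV_ein_minus_ln[of x]] by simp
  qed (use assms in auto)
  also have "(\<lambda>x. ennreal (exp (- x) / x) * indicator {w..} x) =
             (\<lambda>x. ennreal (if x \<in> {w..} then exp (- x) / x else 0))"
    by (auto simp: fun_eq_iff)
  finally have "((\<lambda>x. if x \<in> {w..} then exp (- x) / x else 0) has_integral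
          (ein w - ln w - Ein_const)) UNIV"
    using ge assms by (intro nn_integral_has_integral) (auto simp: algebra_simps)
  then have "((\<lambda>x. exp (- x) / x) has_integral (ein w - ln w - Ein_const)) {w..}"
    by (subst (asm) has_integral_restrict_UNIV)
  then show ?thesis
    by (rule integral_unique)
qed

lemma EI_eq:
  assumes "w \<noteq> 0"
  shows "EI w = ein w - ln \<bar>w\<bar> - Ein_const"
proof (cases "w > 0")
  case True
  then show ?thesis by (simp add: EI_def integral_exp_over_atLeast)
next
  case False
  with assms have w: "w < 0" by simp
  \<comment> \<open>On the negative axis the primitive is \<open>ln (- t) - ein t\<close>.\<close>
  have ftc: "integral {w..-\<epsilon>} (\<lambda>t. exp (- t) / t) = (ln \<epsilon> - ein (- \<epsilon>)) - (ln (- w) - ein w)"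
    if "0 < \<epsilon>" "\<epsilon> < - w" for \<epsilon>
  proof (rule integral_unique)
    have "((\<lambda>t. exp (- t) / t) has_integral
            ((\<lambda>t. ln (- t) - ein t) (- \<epsilon>) - (\<lambda>t. ln (- t) - ein t) w)) {w..-\<epsilon>}"
    proof (rule fundamental_theorem_of_calculus)
      fix t assume t: "t \<in> {w..-\<epsilon>}"
      then have "((\<lambda>t. ln (- t) - ein t) has_field_derivative exp (- t) / t) (at t)"
        using that by (auto intro!: derivative_eq_intros DERIV_ein simp: field_simps)
      then show "((\<lambda>t. ln (- t) - ein t) has_vector_derivative exp (- t) / t) (at t within {w..-\<epsilon>})"
        by (simp add: has_real_derivative_iff_has_vector_derivative has_vector_derivative_at_within)
    qed (use that in auto)
    then show "((\<lambda>t. exp (- t) / t) has_integral (ln \<epsilon> - ein (- \<epsilon>)) - (ln (- w) - ein w)) {w..-\<epsilon>}"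
      by simp
  qed
  have cont: "isCont ein x" for x
    unfolding ein_def
    by (intro isCont_Re isCont_o2[where f = of_real and g = Ein] continuous_of_real continuous_ident
        continuous_Ein)
  \<comment> \<open>The \<open>ln \<epsilon>\<close> from the left of the pole cancels the one from
    the right. What remains of the excision is \<open>ein \<epsilon> - ein (- \<epsilon>)\<close>,
    which vanishes in the limit by continuity at 0.\<close>
  have "((\<lambda>\<epsilon>. ein \<epsilon> - ein (- \<epsilon>) + (ein w - ln (- w) - Ein_const))
          \<longlongrightarrow> ein 0 - ein (- 0) + (ein w - ln (- w) - Ein_const)) (at_right 0)"
    by (intro tendsto_intros isCont_tendsto_compose[OF cont])
  then have "((\<lambda>\<epsilon>. integral {w..-\<epsilon>} (\<lambda>t. exp (-t) / t) + integral {\<epsilon>..} (\<lambda>t. exp (-t) / t))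
          \<longlongrightarrow> ein 0 - ein (- 0) + (ein w - ln (- w) - Ein_const)) (at_right 0)"
  proof (rule Lim_transform_eventually)
    have "eventually (\<lambda>\<epsilon>. \<epsilon> \<in> {0<..<-w}) (at_right 0)"
      using w by (intro eventually_at_right_real) auto
    then show "\<forall>\<^sub>F \<epsilon> in at_right 0. ein \<epsilon> - ein (- \<epsilon>) + (ein w - ln (- w) - Ein_const) =
        integral {w..-\<epsilon>} (\<lambda>t. exp (-t) / t) + integral {\<epsilon>..} (\<lambda>t. exp (-t) / t)"
      by eventually_elim (simp add: ftc integral_exp_over_atLeast)
  qed
  then show ?thesis
    using w by (simp add: EI_def tendsto_Lim)
qed

section \<open>Asymptotics of \<open>Ein - Ln\<close> off the real axis\<close>

text \<open>The point is that the bound does not depend on the sign of the real part: moving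
  horizontally to the right makes \<open>Ein - Ln\<close> converge exponentially, and along the far end a
  vertical segment leads to the real axis.\<close>

lemma Ein_minus_Ln_bound:
  assumes "Im z \<noteq> 0"
  shows "norm (Ein z - Ln z - of_real Ein_const) \<le> exp (- Re z) / \<bar>Im z\<bar>"
proof -
  define L where "L = (\<lambda>z. Ein z - Ln z)"
  have L: "(L has_field_derivative - exp (- z) / z) (at z within S)" if "z \<notin> \<real>\<^sub>\<le>\<^sub>0" for z S
    using that unfolding L_def
    by (auto intro!: derivative_eq_intros simp: diff_divide_distrib inverse_eq_divide)
  \<comment> \<open>Since |z + t| is at least |Im z|, the derivative is dominated by
    \<open>exp (- Re z - t) / \<bar>Im z\<bar>\<close>. The integral of this over all t > 0 is the
    right-hand side, so the bound is uniform in x.\<close>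
  have horizontal: "norm (L (z + of_real x) - L z) \<le> exp (- Re z) / \<bar>Im z\<bar>" if "x > 0" for x
  proof -
    let ?G = "\<lambda>t. L (z + of_real t)" and ?\<phi> = "\<lambda>t. - exp (- Re z - t) / \<bar>Im z\<bar>"
    have slit: "z + of_real t \<notin> \<real>\<^sub>\<le>\<^sub>0" for t
      using assms by (auto simp: complex_nonpos_Reals_iff)
    have G: "(?G has_vector_derivative - exp (- (z + of_real t)) / (z + of_real t)) (at t)" for t
    proof -
      have "((\<lambda>t. L (z + t)) has_field_derivative - exp (- (z + of_real t)) / (z + of_real t)) (at (of_real t))"
        using DERIV_shift[of L "- exp (- (z + of_real t)) / (z + of_real t)" "of_real t" z] L[OF slit]
        by (simp add: add.commute)
      from has_vector_derivative_real_field[OF this] show ?thesis .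
    qed
    have \<phi>: "(?\<phi> has_vector_derivative exp (- Re z - t) / \<bar>Im z\<bar>) (at t)" for t
      unfolding has_real_derivative_iff_has_vector_derivative[symmetric]
      by (rule DERIV_cdivide) (auto intro!: derivative_eq_intros)
    have "norm (?G x - ?G 0) \<le> ?\<phi> x - ?\<phi> 0"
    proof (rule differentiable_bound_general[OF that])
      show "continuous_on {0..x} ?G" "continuous_on {0..x} ?\<phi>"
        using G \<phi> has_vector_derivative_continuous
        by (blast intro: continuous_at_imp_continuous_on)+
      fix t
      have "\<bar>Im z\<bar> \<le> norm (z + of_real t)"
        using abs_Im_le_cmod[of "z + of_real t"] by simp
      then show "norm (- exp (- (z + of_real t)) / (z + of_real t)) \<le> exp (- Re z - t) / \<bar>Im z\<bar>"
        using assms by (auto simp: norm_divide intro!: divide_left_mono mult_pos_pos)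
    qed (rule G \<phi>)+
    also have "\<dots> \<le> exp (- Re z) / \<bar>Im z\<bar>"
      by simp
    finally show ?thesis by simp
  qed
  \<comment> \<open>The segment has length |Im z| and constant real part. Positivity of that real
    part keeps it off the branch cut and bounds |s| from below.\<close>
  have vertical: "norm (L (z + of_real x) - L (of_real (Re z + x)))
                    \<le> exp (- (Re z + x)) / (Re z + x) * \<bar>Im z\<bar>" if "Re z + x > 0" for x
  proof -
    define S where "S = closed_segment (z + of_real x) (of_real (Re z + x))"
    have Re: "Re s = Re z + x" if "s \<in> S" for s
    proof -
      obtain u where "s = (1 - u) *\<^sub>R (z + of_real x) + u *\<^sub>R of_real (Re z + x)"
        using \<open>s \<in> S\<close> unfolding S_def in_segment by blast
      then have "Re s = (1 - u) * (Re z + x) + u * (Re z + x)" by simp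
      then show ?thesis by (simp add: algebra_simps)
    qed
    have slit: "s \<notin> \<real>\<^sub>\<le>\<^sub>0" if "s \<in> S" for s
      using Re[OF that] \<open>Re z + x > 0\<close> by (auto simp: complex_nonpos_Reals_iff)
    have "norm (L (z + of_real x) - L (of_real (Re z + x)))
            \<le> exp (- (Re z + x)) / (Re z + x) * norm (z + of_real x - of_real (Re z + x))"
    proof (rule field_differentiable_bound[where S = S])
      fix s assume s: "s \<in> S"
      show "(L has_field_derivative - exp (- s) / s) (at s within S)"
        by (rule L[OF slit[OF s]])
      show "norm (- exp (- s) / s) \<le> exp (- (Re z + x)) / (Re z + x)"
        using Re[OF s] that complex_Re_le_cmod[of s]
        by (auto simp: norm_divide intro!: divide_left_mono mult_pos_pos)
    qed (auto simp: S_def)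
    also have "z + of_real x - of_real (Re z + x) = \<i> * of_real (Im z)"
      by (simp add: complex_eq_iff)
    finally show ?thesis by (simp add: norm_mult)
  qed
  have shift: "filterlim (\<lambda>x. Re z + x) at_top at_top"
    by real_asymp
  have "((\<lambda>x. exp (- x) / x * \<bar>Im z\<bar>) \<longlongrightarrow> 0) at_top"
    by real_asymp
  from filterlim_compose[OF this shift]
  have lim0: "((\<lambda>x. exp (- (Re z + x)) / (Re z + x) * \<bar>Im z\<bar>) \<longlongrightarrow> 0) at_top" .
  have ev: "eventually (\<lambda>x. Re z + x > 0) at_top"
    using eventually_gt_at_top[of "- Re z"] by eventually_elim auto
  have "((\<lambda>x. L (z + of_real x) - L (of_real (Re z + x))) \<longlongrightarrow> 0) at_top"
    by (rule Lim_null_comparison[OF _ lim0], use ev in eventually_elim) (rule vertical)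
  moreover have "((\<lambda>x. L (of_real (Re z + x))) \<longlongrightarrow> of_real Ein_const) at_top"
  proof (rule Lim_transform_eventually)
    show "((\<lambda>x. complex_of_real (ein (Re z + x) - ln (Re z + x))) \<longlongrightarrow> of_real Ein_const) at_top"
      by (intro tendsto_of_real filterlim_compose[OF tendsto_ein_minus_ln shift])
    show "\<forall>\<^sub>F x in at_top. complex_of_real (ein (Re z + x) - ln (Re z + x)) = L (of_real (Re z + x))"
      using ev by eventually_elim (simp add: L_def Ein_of_real Ln_of_real del: of_real_add)
  qed
  ultimately have "((\<lambda>x. L (z + of_real x)) \<longlongrightarrow> of_real Ein_const) at_top"
    by (rule Lim_transform[rotated])
  \<comment> \<open>With the limit of \<open>L\<close> at the far end identified, x tends to
    infinity in the uniform horizontal bound.\<close>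
  then have "((\<lambda>x. norm (L (z + of_real x) - L z)) \<longlongrightarrow> norm (of_real Ein_const - L z)) at_top"
    by (intro tendsto_intros)
  moreover have "\<forall>\<^sub>F x in at_top. norm (L (z + of_real x) - L z) \<le> exp (- Re z) / \<bar>Im z\<bar>"
    using eventually_gt_at_top[of 0] by eventually_elim (rule horizontal)
  ultimately have "norm (of_real Ein_const - L z) \<le> exp (- Re z) / \<bar>Im z\<bar>"
    by (rule tendsto_upperbound) simp
  then show ?thesis
    by (simp add: L_def norm_minus_commute)
qed

section \<open>Logarithm identities and the vertical integral\<close>

lemma has_contour_integral_linepath_primitive:
  assumes "\<And>z. z \<in> closed_segment p q \<Longrightarrow> (F has_field_derivative f z) (at z)"
  shows "(f has_contour_integral (F q - F p)) (linepath p q)"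
  using contour_integral_primitive[of "closed_segment p q" F f "linepath p q"] assms
  by (auto intro: has_field_derivative_at_within)

text \<open>Reflection in the imaginary axis sends an argument \<theta> to pi - \<theta>. This is
  applied to the pair of points iT + K and iT - K at the two ends of a horizontal line.\<close>

lemma Ln_minus_cnj:
  assumes "Im z > 0"
  shows "Ln z + Ln (- cnj z) = of_real (2 * ln (norm z)) + \<i> * pi"
proof -
  have "z \<noteq> 0" "z \<notin> \<real>\<^sub>\<le>\<^sub>0"
    using assms by (auto simp: complex_nonpos_Reals_iff)
  moreover from this have "Ln (- cnj z) = cnj (Ln z) + \<i> * pi"
    using assms by (subst Ln_minus) (auto simp: cnj_Ln)
  ultimately show ?thesis
    using Re_Ln[of z] by (simp add: complex_eq_iff)
qed

text \<open>Off the slit, conjugation negates the argument, so the imaginary parts cancel.\<close>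

lemma Ln_plus_cnj:
  assumes "z \<notin> \<real>\<^sub>\<le>\<^sub>0"
  shows "Ln z + Ln (cnj z) = of_real (2 * ln (norm z))"
proof -
  have "z \<noteq> 0" using assms by auto
  then show ?thesis
    using Re_Ln[of z] by (simp add: complex_eq_iff flip: cnj_Ln[OF assms])
qed

text \<open>The 1/z from \<open>Ln\<close> cancels the 1/z in the derivative of the
  \<open>Ein\<close> term. Only \<open>Ln z\<close> restricts the domain: the argument of
  \<open>Ein\<close> may be a negative real, as happens on the imaginary axis for w < 0. This is why
  both signs of w are covered at once.\<close>

lemma Ln_minus_Ein_primitive:
  assumes "z \<notin> \<real>\<^sub>\<le>\<^sub>0" "w \<noteq> 0"
  shows "((\<lambda>z. Ln z - Ein (- \<i> * of_real w * z)) has_field_derivative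
           exp (\<i> * of_real w * z) / z) (at z)"
proof -
  have "z \<noteq> 0" using assms by auto
  with assms show ?thesis
    by (auto intro!: derivative_eq_intros simp: field_simps)
qed

lemma has_contour_integral_exp_over_vertical:
  assumes "w \<noteq> 0" "S > 0" "T > 0"
  shows "((\<lambda>z. exp (\<i> * of_real w * z) / z) has_contour_integral
           of_real (EI (w * S) - EI (w * T))) (linepath (\<i> * of_real S) (\<i> * of_real T))"
proof -
  define F where "F = (\<lambda>z. Ln z - Ein (- \<i> * of_real w * z))"
  \<comment> \<open>On the imaginary axis the argument of \<open>Ein\<close> is the real number wt,
    so \<open>F\<close> equals \<open>- EI (w * t)\<close> up to a constant independent of t, which
    drops out of the difference.\<close>
  have F: "F (\<i> * of_real t) = of_real (ln t - ein (w * t)) + \<i> * pi / 2" if "t > 0" for t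
  proof -
    have "- \<i> * of_real w * (\<i> * of_real t) = of_real (w * t)"
      by (simp add: complex_eq_iff)
    then show ?thesis
      using that by (simp add: F_def Ein_of_real Ln_times_of_real[of t \<i>] mult.commute[of \<i>]
          Ln_of_real del: of_real_mult)
  qed
  have "((\<lambda>z. exp (\<i> * of_real w * z) / z) has_contour_integral
          (F (\<i> * of_real T) - F (\<i> * of_real S))) (linepath (\<i> * of_real S) (\<i> * of_real T))"
  proof (rule has_contour_integral_linepath_primitive)
    fix z assume z: "z \<in> closed_segment (\<i> * of_real S) (\<i> * complex_of_real T)"
    have "closed_segment (\<i> * of_real S) (\<i> * complex_of_real T) \<subseteq> {z. Im z > 0}"
      using assms by (intro closed_segment_subset convex_halfspace_Im_gt) auto
    with z have "z \<notin> \<real>\<^sub>\<le>\<^sub>0"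
      by (auto simp: complex_nonpos_Reals_iff)
    then show "(F has_field_derivative exp (\<i> * of_real w * z) / z) (at z)"
      unfolding F_def using assms(1) by (rule Ln_minus_Ein_primitive)
  qed
  also have "F (\<i> * of_real T) - F (\<i> * of_real S) = of_real (EI (w * S) - EI (w * T))"
    using assms by (simp add: F EI_eq abs_mult ln_mult)
  finally show ?thesis .
qed

section \<open>The Digamma series on a period segment\<close>

lemma horizontal_segment:
  "closed_segment (\<i> * of_real T) (\<i> * of_real T + 1) = {z. 0 \<le> Re z \<and> Re z \<le> 1 \<and> Im z = T}"
proof (intro equalityI subsetI)
  fix z assume "z \<in> closed_segment (\<i> * of_real T) (\<i> * of_real T + 1)"
  then show "z \<in> {z. 0 \<le> Re z \<and> Re z \<le> 1 \<and> Im z = T}"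
    by (auto simp: in_segment algebra_simps)
next
  fix z assume "z \<in> {z. 0 \<le> Re z \<and> Re z \<le> 1 \<and> Im z = T}"
  then show "z \<in> closed_segment (\<i> * of_real T) (\<i> * of_real T + 1)"
    unfolding in_segment by (intro exI[of _ "Re z"]) (auto simp: complex_eq_iff algebra_simps)
qed

text \<open>The difference is (z - 1) / ((k + 1)(z + k)). The numerator is at most 1 + T, and |z +
  k| is at least \<open>min T 1 / 2\<close> times k + 1: for k = 0 because of the imaginary part,
  for larger k because k is at least (k + 1) / 2. The absolute value of \<open>Im z\<close> lets the
  bound serve for 1 - z as well.\<close>

lemma Digamma_term_bound:
  fixes z :: complex
  assumes "0 \<le> Re z" "Re z \<le> 1" "\<bar>Im z\<bar> = T" "T > 0"
  shows "norm (inverse (of_nat (Suc k)) - inverse (z + of_nat k))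
           \<le> (1 + T) * 2 / min T 1 * inverse (real (Suc k) ^ 2)"
proof -
  have lb: "min T 1 / 2 * real (Suc k) \<le> norm (z + of_nat k)"
  proof (cases "k = 0")
    case True
    then show ?thesis
      using assms abs_Im_le_cmod[of z] by simp
  next
    case False
    then have "min T 1 / 2 * real (Suc k) \<le> 1 / 2 * real (Suc k)"
      by (intro mult_right_mono) auto
    also have "\<dots> \<le> Re (z + of_nat k)"
      using False assms by simp
    finally show ?thesis
      using complex_Re_le_cmod order_trans by blast
  qed
  have pos: "0 < min T 1 / 2 * real (Suc k)"
    using assms by (intro mult_pos_pos) auto
  then have nz: "z + of_nat k \<noteq> 0"
    using lb by auto
  have "norm (z - 1) \<le> \<bar>Re (z - 1)\<bar> + \<bar>Im (z - 1)\<bar>"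
    by (rule cmod_le)
  also have "\<dots> \<le> 1 + T"
    using assms by simp
  finally have ub: "norm (z - 1) \<le> 1 + T" .
  have "inverse (of_nat (Suc k)) - inverse (z + of_nat k) = (z - 1) / (of_nat (Suc k) * (z + of_nat k))"
    using nz by (simp add: divide_simps del: of_nat_Suc) simp
  then have "norm (inverse (of_nat (Suc k)) - inverse (z + of_nat k))
               = norm (z - 1) / (real (Suc k) * norm (z + of_nat k))"
    by (simp add: norm_divide norm_mult del: of_nat_Suc)
  also have "\<dots> \<le> (1 + T) / (real (Suc k) * (min T 1 / 2 * real (Suc k)))"
    using ub lb pos assms by (intro frac_le mult_left_mono mult_pos_pos) auto
  also have "\<dots> = (1 + T) * 2 / min T 1 * inverse (real (Suc k) ^ 2)"
    using assms by (simp add: field_simps power2_eq_square del: of_nat_Suc)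
  finally show ?thesis .
qed

lemma continuous_on_Digamma_reflected:
  assumes "T > 0"
  shows "continuous_on (closed_segment (\<i> * of_real T) (\<i> * of_real T + 1))
           (\<lambda>z. Digamma z + Digamma (1 - z))"
proof -
  have "z \<notin> \<int>\<^sub>\<le>\<^sub>0" "1 - z \<notin> \<int>\<^sub>\<le>\<^sub>0" if "Im z = T" for z
    using that assms by (auto elim!: nonpos_Ints_cases simp: complex_eq_iff)
  then show ?thesis
    unfolding horizontal_segment
    by (intro continuous_at_imp_continuous_on ballI continuous_add isCont_Polygamma continuous_diff
        continuous_const continuous_ident) auto
qed

text \<open>Integrating the series for \<open>Digamma z + Digamma (1 - z)\<close> termwise unfolds the period segment to
  the whole horizontal line, the part left of the imaginary axis being taken with the opposite
  orientation; the logarithms in the primitive then cancel up to \<open>\<i> * pi\<close>.\<close>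

lemma contour_integral_exp_Digamma:
  assumes w: "w \<noteq> 0" "exp (\<i> * of_real w) = 1" and T: "T > 0"
  shows "contour_integral (linepath (\<i> * of_real T) (\<i> * of_real T + 1))
           (\<lambda>z. exp (\<i> * of_real w * z) * (Digamma z + Digamma (1 - z))) = - 2 * of_real (EI (w * T))"
proof -
  let ?\<gamma> = "linepath (\<i> * of_real T) (\<i> * of_real T + 1)"
  define Y where "Y = closed_segment (\<i> * of_real T) (\<i> * complex_of_real T + 1)"
  define e where "e = (\<lambda>z. exp (\<i> * of_real w * z))"
  define \<psi> where "\<psi> = (\<lambda>z::complex. Digamma z + Digamma (1 - z))"
  \<comment> \<open>The k-th terms of the series for \<open>Digamma z\<close> and
    \<open>Digamma (1 - z)\<close>, without their constants, weighted by \<open>e\<close>.\<close>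
  define g where "g = (\<lambda>k z. e z * ((inverse (of_nat (Suc k)) - inverse (z + of_nat k)) +
                    (inverse (of_nat (Suc k)) - inverse ((1 - z) + of_nat k))))"
  define \<Phi> where "\<Phi> = (\<lambda>z. Ln z - Ein (- \<i> * of_real w * z))"
  \<comment> \<open>Up to the constant \<open>D 0\<close>, \<open>D K\<close> is the integral of the
    first K terms: minus the integral of \<open>e z / z\<close> from iT to iT + K, plus the one from
    iT - K to iT, written through the primitive \<open>\<Phi>\<close>.\<close>
  define D where "D = (\<lambda>k. - \<Phi> (\<i> * of_real T + of_nat k) - \<Phi> (\<i> * of_real T - of_nat k))"

  have Y: "z \<in> Y \<longleftrightarrow> 0 \<le> Re z \<and> Re z \<le> 1 \<and> Im z = T" for z
    unfolding Y_def horizontal_segment by simp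
  have norm_e: "norm (e z) = exp (- w * T)" if "z \<in> Y" for z
    using that by (simp add: e_def Y)
  have e_int: "e (z + of_nat k) = e z" for z k
    by (simp add: e_def distrib_left exp_add w(2) exp_of_nat2_mult)
  have e_int': "e (z - of_nat k) = e z" for z k
    using e_int[of "z - of_nat k" k] by simp

  \<comment> \<open>Each of the two Digamma series contributes one
    \<open>euler_mascheroni\<close>.\<close>
  have g_suminf: "(\<Sum>k. g k z) = e z * (\<psi> z + 2 * euler_mascheroni)" if "z \<in> Y" for z
  proof -
    have nz: "z \<noteq> 0" "1 - z \<noteq> 0"
      using that T by (auto simp: Y complex_eq_iff)
    have "(\<lambda>k. inverse (of_nat (Suc k)) - inverse (s + of_nat k)) sums (Digamma s + euler_mascheroni)"
      if "s \<noteq> 0" for s :: complex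
      using summable_sums[OF summable_Digamma[OF that]] by (simp add: Digamma_def)
    from sums_mult[OF sums_add[OF this[OF nz(1)] this[OF nz(2)]], of "e z"]
    have "(\<lambda>k. g k z) sums (e z * (\<psi> z + 2 * euler_mascheroni))"
      by (simp add: g_def \<psi>_def algebra_simps)
    then show ?thesis by (rule sums_unique[symmetric])
  qed
  have "uniform_limit Y (\<lambda>K z. \<Sum>k<K. g k z) (\<lambda>z. \<Sum>k. g k z) sequentially"
  proof (rule Weierstrass_m_test)
    let ?M = "\<lambda>k. (1 + T) * 2 / min T 1 * inverse (real (Suc k) ^ 2)"
    show "norm (g k z) \<le> exp (- w * T) * (?M k + ?M k)" if "z \<in> Y" for k z
    proof -
      have "norm ((inverse (of_nat (Suc k)) - inverse (z + of_nat k)) +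
                    (inverse (of_nat (Suc k)) - inverse ((1 - z) + of_nat k))) \<le> ?M k + ?M k"
        using that T by (intro order_trans[OF norm_triangle_ineq] add_mono Digamma_term_bound)
          (auto simp: Y)
      then show ?thesis
        unfolding g_def norm_mult norm_e[OF that] by (rule mult_left_mono) simp
    qed
    have "summable (\<lambda>k. inverse (real (Suc k) ^ 2))"
      using inverse_power_summable[of 2, where 'a = real] by (subst summable_Suc_iff) simp
    then show "summable (\<lambda>k. exp (- w * T) * (?M k + ?M k))"
      by (intro summable_mult summable_add)
  qed
  then have ulim: "uniform_limit (path_image ?\<gamma>) (\<lambda>K z. \<Sum>k<K. g k z)
                     (\<lambda>z. e z * (\<psi> z + 2 * euler_mascheroni)) sequentially"
    by (subst (asm) uniform_limit_cong'[where i = "\<lambda>z. e z * (\<psi> z + 2 * euler_mascheroni)"])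
       (auto simp: g_suminf Y_def)

  have g_int: "(g k has_contour_integral (D (Suc k) - D k)) ?\<gamma>" for k
  proof -
    \<comment> \<open>By periodicity of \<open>e\<close>, its shifts by k and by -(k + 1) reduce to
      \<open>\<Phi>\<close>. The second shift is k + 1 because 1 - z + k = -(z - (k + 1)). The first
      summand has period 1 and contributes nothing over the segment.\<close>
    define F where "F = (\<lambda>z. e z / (\<i> * of_real w) * (2 * inverse (of_nat (Suc k)))
                          - \<Phi> (z + of_nat k) + \<Phi> (z - of_nat (Suc k)))"
    have \<Phi>_shift: "((\<lambda>z. \<Phi> (z + s)) has_field_derivative e (z + s) / (z + s)) (at z)"
      if "z + s \<notin> \<real>\<^sub>\<le>\<^sub>0" for z s
      using Ln_minus_Ein_primitive[OF that w(1)] unfolding \<Phi>_def e_def DERIV_shift .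
    have "(g k has_contour_integral (F (\<i> * of_real T + 1) - F (\<i> * of_real T))) ?\<gamma>"
    proof (rule has_contour_integral_linepath_primitive)
      fix z assume "z \<in> closed_segment (\<i> * of_real T) (\<i> * complex_of_real T + 1)"
      then have z: "Im z = T"
        by (simp add: horizontal_segment)
      have slit: "z + of_real x \<notin> \<real>\<^sub>\<le>\<^sub>0" for x
        using z T by (auto simp: complex_nonpos_Reals_iff)
      have 1: "((\<lambda>z. e z / (\<i> * of_real w) * (2 * inverse (of_nat (Suc k)))) has_field_derivative
              e z * (2 * inverse (of_nat (Suc k)))) (at z)"
        unfolding e_def using w(1) by (auto intro!: derivative_eq_intros)
      have 2: "((\<lambda>z. \<Phi> (z + of_nat k)) has_field_derivative e z / (z + of_nat k)) (at z)"
        using \<Phi>_shift[of z "of_nat k"] slit[of "of_nat k"] by (simp add: e_int)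
      have 3: "((\<lambda>z. \<Phi> (z - of_nat (Suc k))) has_field_derivative e z / (z - of_nat (Suc k))) (at z)"
        using \<Phi>_shift[of z "- of_nat (Suc k)"] slit[of "- of_nat (Suc k)"] e_int'[of z "Suc k"]
        by (simp del: of_nat_Suc)
      have "inverse (1 - z + of_nat k) = - inverse (z - of_nat (Suc k))"
        by (simp add: minus_diff_eq flip: inverse_minus_eq)
      then have "g k z = e z * (2 * inverse (of_nat (Suc k))) - e z / (z + of_nat k)
                    + e z / (z - of_nat (Suc k))"
        by (simp add: g_def divide_inverse ring_distribs del: of_nat_Suc)
      then show "(F has_field_derivative g k z) (at z)"
        unfolding F_def using DERIV_add[OF DERIV_diff[OF 1 2] 3] by simp
    qed
    also have "F (\<i> * of_real T + 1) - F (\<i> * of_real T) = D (Suc k) - D k"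
      using e_int[of "\<i> * of_real T" 1] by (simp add: F_def D_def algebra_simps)
    finally show ?thesis .
  qed
  have sum_int: "((\<lambda>z. \<Sum>k<K. g k z) has_contour_integral (D K - D 0)) ?\<gamma>" for K
    using has_contour_integral_sum[of "{..<K}" g "\<lambda>k. D (Suc k) - D k" ?\<gamma>] g_int
    by (simp add: sum_lessThan_telescope)
  have "(\<lambda>K. contour_integral ?\<gamma> (\<lambda>z. \<Sum>k<K. g k z))
          \<longlonglongrightarrow> contour_integral ?\<gamma> (\<lambda>z. e z * (\<psi> z + 2 * euler_mascheroni))"
  proof (rule contour_integral_uniform_limit(2)[OF _ ulim])
    show "\<forall>\<^sub>F K in sequentially. (\<lambda>z. \<Sum>k<K. g k z) contour_integrable_on ?\<gamma>"
      using sum_int has_contour_integral_integrable by (intro always_eventually allI) blast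
    show "norm (vector_derivative ?\<gamma> (at t)) \<le> 1" if "t \<in> {0..1}" for t
      by simp
  qed auto
  then have lim1: "(\<lambda>K. D K - D 0) \<longlonglongrightarrow> contour_integral ?\<gamma> (\<lambda>z. e z * (\<psi> z + 2 * euler_mascheroni))"
    by (simp add: contour_integral_unique[OF sum_int])

  \<comment> \<open>The limit of \<open>D K\<close>: in \<open>Ein u + Ein (cnj u)\<close> the main
    part is \<open>2 * ln (norm u) + 2 * Ein_const\<close>, with norm u = |w| norm z, while the two
    logarithms of \<open>\<Phi>\<close> sum to \<open>2 * ln (norm z)\<close> plus i pi. The growing
    terms cancel.\<close>
  define d where "d = of_real (2 * ln \<bar>w\<bar> + 2 * Ein_const) - \<i> * of_real pi"
  have "(\<lambda>K. D K - d) \<longlonglongrightarrow> 0"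
  proof (rule Lim_null_comparison)
    show "\<forall>\<^sub>F K in sequentially. norm (D K - d) \<le> 2 * exp (- (w * T)) / (\<bar>w\<bar> * real K)"
      using eventually_gt_at_top[of 0]
    proof eventually_elim
      case (elim K)
      define z where "z = of_nat K + \<i> * of_real T"
      \<comment> \<open>Here Re u = wT stays fixed while |Im u| = |w| K grows, so the error decays
        like 1/K even when wT is negative.\<close>
      define u where "u = - \<i> * of_real w * z"
      have u: "Re u = w * T" "Im u = - w * real K"
        by (simp_all add: u_def z_def)
      have "Im z > 0" using T by (simp add: z_def)
      \<comment> \<open>The left end is the mirror image of the right end, and its argument of
        \<open>Ein\<close> is the conjugate of \<open>u\<close>.\<close>
      have z': "\<i> * of_real T - of_nat K = - cnj z" and cu: "- \<i> * of_real w * (- cnj z) = cnj u"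
        by (simp_all add: z_def u_def complex_eq_iff)
      have nz: "Im u \<noteq> 0" "Im (cnj u) \<noteq> 0"
        using w elim u by auto
      then have "u \<notin> \<real>\<^sub>\<le>\<^sub>0"
        by (auto simp: complex_nonpos_Reals_iff)
      have "norm z > 0" using \<open>Im z > 0\<close> by auto
      have "D K = (Ein u + Ein (cnj u)) - (Ln z + Ln (- cnj z))"
        unfolding D_def z' \<Phi>_def cu by (simp add: z_def u_def add.commute)
      also have "\<dots> - d = (Ein u - Ln u - of_real Ein_const) + (Ein (cnj u) - Ln (cnj u) - of_real Ein_const)"
        using Ln_minus_cnj[OF \<open>Im z > 0\<close>] Ln_plus_cnj[OF \<open>u \<notin> \<real>\<^sub>\<le>\<^sub>0\<close>] w(1) \<open>norm z > 0\<close>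
        by (simp add: d_def u_def norm_mult ln_mult algebra_simps)
      finally have "norm (D K - d) \<le> exp (- Re u) / \<bar>Im u\<bar> + exp (- Re (cnj u)) / \<bar>Im (cnj u)\<bar>"
        using norm_triangle_mono[OF Ein_minus_Ln_bound[OF nz(1)] Ein_minus_Ln_bound[OF nz(2)]]
        by simp
      then show ?case
        by (simp add: u abs_mult)
    qed
    show "(\<lambda>K. 2 * exp (- (w * T)) / (\<bar>w\<bar> * real K)) \<longlonglongrightarrow> 0"
      using w(1) by real_asymp
  qed
  then have "(\<lambda>K. D K - D 0) \<longlonglongrightarrow> d - D 0"
    by (intro tendsto_diff) (auto simp: LIM_zero_iff)
  with lim1 have int1: "contour_integral ?\<gamma> (\<lambda>z. e z * (\<psi> z + 2 * euler_mascheroni)) = d - D 0"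
    by (rule LIMSEQ_unique)
  \<comment> \<open>Both half lines start at iT, so \<open>D 0\<close> is minus twice
    \<open>\<Phi>\<close> there; its imaginary part -pi matches that of \<open>d\<close>.\<close>
  have "Ln (\<i> * of_real T) = of_real (ln T) + \<i> * pi / 2"
    using T by (simp add: Ln_times_of_real[of T \<i>] mult.commute[of \<i>] Ln_of_real)
  moreover have "- \<i> * of_real w * (\<i> * of_real T) = of_real (w * T)"
    by (simp add: complex_eq_iff)
  ultimately have "D 0 = - 2 * (of_real (ln T - ein (w * T)) + \<i> * pi / 2)"
    by (simp add: D_def \<Phi>_def Ein_of_real del: of_real_mult)
  then have int2: "d - D 0 = - 2 * of_real (EI (w * T))"
    using w T by (simp add: d_def EI_eq abs_mult ln_mult algebra_simps)

  \<comment> \<open>The integral of \<open>e\<close> over a full period vanishes, which removes the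
    \<open>euler_mascheroni\<close> term.\<close>
  have e_int0: "((\<lambda>z. 2 * euler_mascheroni * e z) has_contour_integral 0) ?\<gamma>"
  proof -
    define F where "F = (\<lambda>z. 2 * euler_mascheroni * (e z / (\<i> * of_real w)))"
    have "((\<lambda>z. 2 * euler_mascheroni * e z) has_contour_integral
            (F (\<i> * of_real T + 1) - F (\<i> * of_real T))) ?\<gamma>"
      unfolding F_def e_def using w(1)
      by (intro has_contour_integral_linepath_primitive) (auto intro!: derivative_eq_intros)
    then show ?thesis
      using e_int[of "\<i> * of_real T" 1] by (simp add: F_def)
  qed
  have "(\<lambda>z. e z * \<psi> z) contour_integrable_on ?\<gamma>"
    unfolding e_def \<psi>_def
    by (intro contour_integrable_continuous_linepath continuous_intros
        continuous_on_Digamma_reflected T)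
  then have "((\<lambda>z. e z * \<psi> z + 2 * euler_mascheroni * e z) has_contour_integral
               (contour_integral ?\<gamma> (\<lambda>z. e z * \<psi> z) + 0)) ?\<gamma>"
    by (intro has_contour_integral_add e_int0 has_contour_integral_integral)
  from contour_integral_unique[OF this] show ?thesis
    using int1 int2 by (simp add: e_def \<psi>_def algebra_simps)
qed

section \<open>Termwise integration and assembly\<close>

text \<open>The Weierstrass M-test gives uniform convergence along the net of finite index sets, and
  contour integrals pass to uniform limits. The unordered form fits a series over the nonzero
  integers.\<close>

lemma has_sum_contour_integral_linepath:
  assumes cont: "\<And>n. n \<in> A \<Longrightarrow> continuous_on (closed_segment p q) (h n)"
    and sum: "\<And>z. z \<in> closed_segment p q \<Longrightarrow> ((\<lambda>n. h n z) has_sum F z) A"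
    and le: "\<And>n z. n \<in> A \<Longrightarrow> z \<in> closed_segment p q \<Longrightarrow> norm (h n z) \<le> M n"
    and M: "M summable_on A"
  shows "((\<lambda>n. contour_integral (linepath p q) (h n)) has_sum contour_integral (linepath p q) F) A"
proof -
  have int: "h n contour_integrable_on linepath p q" if "n \<in> A" for n
    by (intro contour_integrable_continuous_linepath cont that)
  have fin: "eventually (\<lambda>B. finite B \<and> B \<subseteq> A) (finite_subsets_at_top A)"
    by (auto intro: eventually_finite_subsets_at_top_weakI)
  have "((\<lambda>B. contour_integral (linepath p q) (\<lambda>z. \<Sum>n\<in>B. h n z))
          \<longlongrightarrow> contour_integral (linepath p q) F) (finite_subsets_at_top A)"
  proof (rule contour_integral_uniform_limit(2))
    show "uniform_limit (path_image (linepath p q)) (\<lambda>B z. \<Sum>n\<in>B. h n z) F (finite_subsets_at_top A)"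
      using le sum M by (intro Weierstrass_m_test_general'[where M = M]) auto
    show "\<forall>\<^sub>F B in finite_subsets_at_top A. (\<lambda>z. \<Sum>n\<in>B. h n z) contour_integrable_on linepath p q"
      using fin by eventually_elim (auto intro!: contour_integrable_sum int)
    show "norm (vector_derivative (linepath p q) (at t)) \<le> norm (q - p)" if "t \<in> {0..1}" for t
      by simp
  qed auto
  then have "((\<lambda>B. \<Sum>n\<in>B. contour_integral (linepath p q) (h n))
          \<longlongrightarrow> contour_integral (linepath p q) F) (finite_subsets_at_top A)"
  proof (rule Lim_transform_eventually)
    show "\<forall>\<^sub>F B in finite_subsets_at_top A. contour_integral (linepath p q) (\<lambda>z. \<Sum>n\<in>B. h n z) =
            (\<Sum>n\<in>B. contour_integral (linepath p q) (h n))"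
      using fin by eventually_elim (auto intro!: contour_integral_sum int)
  qed
  then show ?thesis
    by (simp add: has_sum_def)
qed

theorem theorem1p1:
  fixes f :: "complex \<Rightarrow> complex" and a :: "int \<Rightarrow> complex" and T :: real
  assumes "weakly_holomorphic_modular_function f"
    and "has_fourier_expansion f a"
    and "a 0 = 0"
    and "T > 0"
  shows "(\<lambda>n. a n * of_real (EI (2 * pi * of_int n))) summable_on {n. n \<noteq> 0} \<and>
         reg_integral_CQ a =
           2 * contour_integral (linepath \<i> (\<i> * of_real T)) (\<lambda>z. f z / z)
           - contour_integral (linepath (\<i> * of_real T) (\<i> * of_real T + 1))
               (\<lambda>z. f z * (Digamma z + Digamma (1 - z)))"
proof -
  let ?A = "{n::int. n \<noteq> 0}"
  let ?\<gamma>1 = "linepath \<i> (\<i> * of_real T)" and ?\<gamma>2 = "linepath (\<i> * of_real T) (\<i> * of_real T + 1)"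
  define e where "e = (\<lambda>(n::int) z. exp (\<i> * of_real (2 * pi * of_int n) * z))"
  have norm_e: "norm (e n z) = exp (- (2 * pi * of_int n * Im z))" for n z
    by (simp add: e_def)
  have cont_e: "continuous_on S (e n)" for n S
    unfolding e_def by (intro continuous_intros)
  have expansion: "((\<lambda>n. a n * e n z) has_sum f z) ?A" if "Im z > 0" for z
  proof -
    have "((\<lambda>n. a n * e n z) has_sum f z) UNIV"
    proof -
      have "e n z = exp (2 * of_real pi * \<i> * of_int n * z)" for n
        by (simp add: e_def algebra_simps)
      then show ?thesis
        using assms(2) that by (simp add: has_fourier_expansion_def upper_half_plane_def)
    qed
    then show ?thesis
      by (rule has_sum_cong_neutral[THEN iffD1, rotated -1]) (auto simp: assms(3))
  qed
  \<comment> \<open>Unordered summability of complex numbers is absolute; the expansion is evaluated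
    at z = iy.\<close>
  have abs_summable: "(\<lambda>n. norm (a n) * exp (- (2 * pi * of_int n * y))) summable_on ?A" if "y > 0" for y
    using expansion[of "\<i> * of_real y"] that
    by (auto dest!: has_sum_imp_summable simp: summable_on_iff_abs_summable_on_complex norm_mult norm_e)

  have vertical: "((\<lambda>n. a n * of_real (EI (2 * pi * of_int n) - EI (2 * pi * of_int n * T)))
      has_sum contour_integral ?\<gamma>1 (\<lambda>z. f z / z)) ?A"
  proof -
    \<comment> \<open>The norm of \<open>e n z\<close> is monotone in \<open>Im z\<close>, in a
      direction given by the sign of n. Between heights 1 and T it is therefore at most the sum of
      its values at both heights. The divisor \<open>min 1 T\<close> bounds |z| from below, also for
      T < 1.\<close>
    define M where "M = (\<lambda>n::int. norm (a n) * exp (- (2 * pi * of_int n * 1)) / min 1 T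
                               + norm (a n) * exp (- (2 * pi * of_int n * T)) / min 1 T)"
    have seg: "Re z = 0 \<and> min 1 T \<le> Im z \<and> Im z \<le> max 1 T"
      if "z \<in> closed_segment \<i> (\<i> * complex_of_real T)" for z
    proof -
      obtain u where u: "0 \<le> u" "u \<le> 1" "z = (1 - u) *\<^sub>R \<i> + u *\<^sub>R (\<i> * of_real T)"
        using \<open>z \<in> _\<close> by (auto simp: in_segment)
      then have "Im z \<in> closed_segment 1 T"
        by (auto simp: in_segment)
      with u show ?thesis
        by (auto simp: closed_segment_eq_real_ivl split: if_splits)
    qed
    have "((\<lambda>n. contour_integral ?\<gamma>1 (\<lambda>z. a n * e n z / z)) has_sum
            contour_integral ?\<gamma>1 (\<lambda>z. f z / z)) ?A"
    proof (rule has_sum_contour_integral_linepath[where M = M])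
      show "continuous_on (closed_segment \<i> (\<i> * of_real T)) (\<lambda>z. a n * e n z / z)" for n
        using seg assms(4) by (intro continuous_intros cont_e) fastforce
      show "((\<lambda>n. a n * e n z / z) has_sum f z / z) ?A"
        if "z \<in> closed_segment \<i> (\<i> * of_real T)" for z
        unfolding divide_inverse using seg[OF that] assms(4)
        by (intro has_sum_cmult_left expansion) auto
      show "norm (a n * e n z / z) \<le> M n" if "z \<in> closed_segment \<i> (\<i> * of_real T)" for n z
      proof -
        have "min 1 T \<le> norm z"
          using seg[OF that] abs_Im_le_cmod[of z] by linarith
        moreover have "exp (- (2 * pi * of_int n * Im z))
            \<le> exp (- (2 * pi * of_int n * 1)) + exp (- (2 * pi * of_int n * T))"
        proof -
          have "min (2 * pi * of_int n * 1) (2 * pi * of_int n * T) \<le> 2 * pi * of_int n * Im z"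
          proof (cases "n \<ge> 0")
            case True
            have "2 * pi * of_int n * min 1 T \<le> 2 * pi * of_int n * Im z"
              using seg[OF that] True by (intro mult_left_mono) auto
            then show ?thesis by (auto simp: min_def split: if_splits)
          next
            case False
            have "2 * pi * of_int n * max 1 T \<le> 2 * pi * of_int n * Im z"
              using seg[OF that] False by (intro mult_left_mono_neg) (auto simp: mult_nonneg_nonpos)
            then show ?thesis by (auto simp: max_def min_def split: if_splits)
          qed
          then have "exp (- (2 * pi * of_int n * Im z)) \<le> exp (- (2 * pi * of_int n * 1)) \<or>
              exp (- (2 * pi * of_int n * Im z)) \<le> exp (- (2 * pi * of_int n * T))"
            by (auto simp: min_def split: if_splits)
          then show ?thesis
            using exp_gt_zero[of "- (2 * pi * of_int n * 1)"] exp_gt_zero[of "- (2 * pi * of_int n * T)"]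
            by linarith
        qed
        ultimately have "norm (a n) * exp (- (2 * pi * of_int n * Im z)) / norm z
            \<le> norm (a n) * (exp (- (2 * pi * of_int n * 1)) + exp (- (2 * pi * of_int n * T))) / min 1 T"
          using assms(4) by (intro frac_le mult_left_mono) (auto intro!: mult_nonneg_nonneg add_nonneg_nonneg)
        then show ?thesis
          by (simp only: M_def norm_divide norm_mult norm_e distrib_left add_divide_distrib)
      qed
      show "M summable_on ?A"
        unfolding M_def divide_inverse using assms(4)
        by (intro summable_on_add summable_on_cmult_left abs_summable) auto
    qed
    also have "?this \<longleftrightarrow> ?thesis"
    proof (rule has_sum_cong)
      fix n :: int assume "n \<in> ?A"
      then have "((\<lambda>z. e n z / z) has_contour_integral
          of_real (EI (2 * pi * of_int n * 1) - EI (2 * pi * of_int n * T))) ?\<gamma>1"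
        using has_contour_integral_exp_over_vertical[of "2 * pi * of_int n" 1 T] assms(4)
        by (simp add: e_def)
      from has_contour_integral_lmul[OF this, of "a n"]
      show "contour_integral ?\<gamma>1 (\<lambda>z. a n * e n z / z) =
          a n * of_real (EI (2 * pi * of_int n) - EI (2 * pi * of_int n * T))"
        by (intro contour_integral_unique) simp
    qed
    finally show ?thesis .
  qed

  have horizontal: "((\<lambda>n. a n * (- 2 * of_real (EI (2 * pi * of_int n * T))))
      has_sum contour_integral ?\<gamma>2 (\<lambda>z. f z * (Digamma z + Digamma (1 - z)))) ?A"
  proof -
    define \<psi> where "\<psi> = (\<lambda>z::complex. Digamma z + Digamma (1 - z))"
    let ?Y = "closed_segment (\<i> * of_real T) (\<i> * complex_of_real T + 1)"
    have cont: "continuous_on ?Y \<psi>"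
      unfolding \<psi>_def by (rule continuous_on_Digamma_reflected[OF assms(4)])
    \<comment> \<open>A bound for \<open>\<psi>\<close> on the compact segment, together with the
      constancy of the norm of \<open>e n\<close> at height T, yields the majorant.\<close>
    then have "bounded (\<psi> ` ?Y)"
      by (intro compact_imp_bounded compact_continuous_image) auto
    then obtain B where B: "\<And>z. z \<in> ?Y \<Longrightarrow> norm (\<psi> z) \<le> B"
      by (auto simp: bounded_iff)
    have "((\<lambda>n. contour_integral ?\<gamma>2 (\<lambda>z. a n * e n z * \<psi> z)) has_sum
            contour_integral ?\<gamma>2 (\<lambda>z. f z * \<psi> z)) ?A"
    proof (rule has_sum_contour_integral_linepath
        [where M = "\<lambda>n. norm (a n) * exp (- (2 * pi * of_int n * T)) * B"])
      show "continuous_on ?Y (\<lambda>z. a n * e n z * \<psi> z)" for n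
        by (intro continuous_intros cont_e cont)
      show "((\<lambda>n. a n * e n z * \<psi> z) has_sum f z * \<psi> z) ?A" if "z \<in> ?Y" for z
        using that assms(4) by (intro has_sum_cmult_left expansion) (auto simp: horizontal_segment)
      show "norm (a n * e n z * \<psi> z) \<le> norm (a n) * exp (- (2 * pi * of_int n * T)) * B"
        if z: "z \<in> ?Y" for n z
      proof -
        have "Im z = T" using z by (simp add: horizontal_segment)
        then show ?thesis
          unfolding norm_mult norm_e by (intro mult_mono B z) auto
      qed
      show "(\<lambda>n. norm (a n) * exp (- (2 * pi * of_int n * T)) * B) summable_on ?A"
        by (intro summable_on_cmult_left abs_summable assms(4))
    qed
    also have "?this \<longleftrightarrow> ((\<lambda>n. a n * (- 2 * of_real (EI (2 * pi * of_int n * T)))) has_sum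
            contour_integral ?\<gamma>2 (\<lambda>z. f z * \<psi> z)) ?A"
    proof (rule has_sum_cong)
      fix n :: int assume n: "n \<in> ?A"
      have "exp (\<i> * of_real (2 * pi * of_int n)) = 1"
        unfolding exp_eq_1 by (auto intro!: exI[of _ n])
      then have "contour_integral ?\<gamma>2 (\<lambda>z. e n z * \<psi> z) = - 2 * of_real (EI (2 * pi * of_int n * T))"
        using n assms(4) contour_integral_exp_Digamma[of "2 * pi * of_int n" T]
        by (simp add: e_def \<psi>_def)
      moreover have "(\<lambda>z. e n z * \<psi> z) contour_integrable_on ?\<gamma>2"
        by (intro contour_integrable_continuous_linepath continuous_intros cont_e cont)
      ultimately show "contour_integral ?\<gamma>2 (\<lambda>z. a n * e n z * \<psi> z) =
          a n * (- 2 * of_real (EI (2 * pi * of_int n * T)))"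
        by (simp add: mult.assoc contour_integral_lmul)
    qed
    finally show ?thesis
      by (simp add: \<psi>_def)
  qed

  \<comment> \<open>Adding -1/2 times the horizontal series to the vertical one cancels the terms in
    \<open>EI (2 * pi * of_int n * T)\<close>. Convergence of the remaining series comes with its
    value.\<close>
  have "((\<lambda>n. a n * of_real (EI (2 * pi * of_int n))) has_sum
          (contour_integral ?\<gamma>1 (\<lambda>z. f z / z)
            + - 1 / 2 * contour_integral ?\<gamma>2 (\<lambda>z. f z * (Digamma z + Digamma (1 - z))))) ?A"
    using has_sum_add[OF vertical has_sum_cmult_right[OF horizontal, of "- 1 / 2"]]
    by (simp add: algebra_simps)
  then show ?thesis
    by (auto simp: reg_integral_CQ_def infsumI dest: has_sum_imp_summable)
qed

end
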